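(* Let $d\ge1$ be an integer. For all nonnegative integers $n_1,\ldots,n_d$, $$\mathsf{p}(n_1,\ldots,n_d)=\left|\left\{\pi\in\mathcal{P}^{(d)}:(c_1(\pi),\ldots,c_d(\pi))=(n_1,\ldots,n_d)\right\}\right|.$$
   Context: A $d$-dimensional partition is an array $\pi = (\pi_{i_1,\ldots,i_d})_{i_1,\ldots,i_d\ge 1}$ of nonnegative integers with only finitely many nonzero entries such that $\pi_{i_1,\ldots,i_d}\ge \pi_{j_1,\ldots,j_d}$ whenever $i_1\le j_1,\ldots,i_d\le j_d$; $\mathcal{P}^{(d)}$ is the set of all $d$-dimensional partitions. With $\mathbb{Z}_+$ the set of positive integers, the diagram of $\pi$ is $D(\pi)=\{(i_1,\ldots,i_d,i)\in\mathbb{Z}_+^{d+1}: 1\le i\le\pi_{i_1,\ldots,i_d}\}$. Let $\mathbf{e}_1,\ldots,\mathbf{e}_{d+1}$ be the standard basis of $\mathbb{Z}^{d+1}$ and $[d]=\{1,\ldots,d\}$. The set of corners of $\pi$ is $$\mathrm{Cor}(\pi)=\{\mathbf{i}\in\mathbb{Z}_+^{d+1}:\mathbf{i}\in D(\pi),\ \mathbf{i}+\mathbf{e}_\ell\notin D(\pi)\text{ for all }\ell\in[d]\}$$ (only the first $d$ directions are tested). For $\ell\in[d]$ define $$c_\ell(\pi)=\sum_{(i_1,\ldots,i_{d+1})\in\mathrm{Cor}(\pi)}i_\ell.$$ The vector partition numbers $\mathsf{p}(n_1,\ldots,n_d)$ are defined by the formal power series identity $$\sum_{n_1,\ldots,n_d\ge0}\mathsf{p}(n_1,\ldots,n_d)\,x_1^{n_1}\cdots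 x_d^{n_d} = \prod_{i_1,\ldots,i_d\ge1}\left(1-x_1^{i_1}\cdots x_d^{i_d}\right)^{-1}.$$ *)

theory Defs
  imports "HOL-Analysis.Analysis"
begin

text \<open>
  Formal power series in the variables indexed by \<open>'d\<close>: exponents are vectors in \<open>nat ^ 'd\<close>,
  and \<open>Abs_mfps a\<close> has coefficient \<open>a n\<close> at the monomial with exponent \<open>n\<close>.
\<close>

typedef ('a, 'd) mfps = "UNIV :: (nat ^ 'd::finite \<Rightarrow> 'a) set"
  morphisms mfps_nth Abs_mfps
  by simp

lemma mfps_nth_Abs [simp]: "mfps_nth (Abs_mfps a) = a"
  by (simp add: Abs_mfps_inverse)

lemma mfps_eqI: "(\<And>n. mfps_nth f n = mfps_nth g n) \<Longrightarrow> f = g"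
  by (metis ext mfps_nth_inject)

definition splits :: "nat ^ 'd::finite \<Rightarrow> ((nat ^ 'd) \<times> (nat ^ 'd)) set" where
  "splits n = {(a, b). a + b = n}"

lemma finite_vec_atMost: "finite {a :: nat ^ 'd::finite. a \<le> n}"
proof (rule finite_subset)
  show "{a. a \<le> n} \<subseteq> vec_lambda ` (Pi\<^sub>E UNIV (\<lambda>l. {.. n $ l}))"
  proof
    fix a assume "a \<in> {a. a \<le> n}"
    then have "vec_nth a \<in> Pi\<^sub>E UNIV (\<lambda>l. {.. n $ l})" by (auto simp: less_eq_vec_def)
    then show "a \<in> vec_lambda ` (Pi\<^sub>E UNIV (\<lambda>l. {.. n $ l}))"
      by (metis imageI vec_nth_inverse)
  qed
  show "finite (vec_lambda ` (Pi\<^sub>E (UNIV :: 'd set) (\<lambda>l. {.. n $ l})))"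
    by (intro finite_imageI finite_PiE) auto
qed

lemma splits_le: "(a, b) \<in> splits n \<Longrightarrow> a \<le> n" "(a, b) \<in> splits n \<Longrightarrow> b \<le> n"
  by (auto simp: splits_def less_eq_vec_def)

lemma finite_splits [simp]: "finite (splits n)"
proof (rule finite_subset)
  show "splits n \<subseteq> {a. a \<le> n} \<times> {b. b \<le> n}" using splits_le by fast
qed (simp add: finite_vec_atMost)

instantiation mfps :: (comm_ring_1, finite) comm_ring_1
begin

definition zero_mfps where "0 = Abs_mfps (\<lambda>_. 0)"
definition one_mfps where "1 = Abs_mfps (\<lambda>n. if n = 0 then 1 else 0)"
definition plus_mfps where "f + g = Abs_mfps (\<lambda>n. mfps_nth f n + mfps_nth g n)"
definition uminus_mfps where "- f = Abs_mfps (\<lambda>n. - mfps_nth f n)"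
definition minus_mfps where "f - g = Abs_mfps (\<lambda>n. mfps_nth f n - mfps_nth g n)"
definition times_mfps where
  "f * g = Abs_mfps (\<lambda>n. \<Sum>(a, b)\<in>splits n. mfps_nth f a * mfps_nth g b)"

lemma mfps_mult_commute: "f * g = g * (f :: ('a, 'b) mfps)"
proof (rule mfps_eqI)
  fix n
  show "mfps_nth (f * g) n = mfps_nth (g * f) n"
    unfolding times_mfps_def mfps_nth_Abs
    by (rule sum.reindex_bij_witness[of _ prod.swap prod.swap])
       (auto simp: splits_def add.commute mult.commute)
qed

lemma mfps_mult_assoc: "(f * g) * h = f * (g * (h :: ('a, 'b) mfps))"
proof (rule mfps_eqI)
  fix n
  let ?f = "mfps_nth f" and ?g = "mfps_nth g" and ?h = "mfps_nth h"
  have "mfps_nth ((f * g) * h) n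
      = (\<Sum>p\<in>splits n. \<Sum>q\<in>splits (fst p). ?f (fst q) * ?g (snd q) * ?h (snd p))"
    by (simp add: times_mfps_def case_prod_unfold sum_distrib_right)
  also have "\<dots> = (\<Sum>(p, q)\<in>Sigma (splits n) (\<lambda>p. splits (fst p)).
      ?f (fst q) * ?g (snd q) * ?h (snd p))"
    by (subst sum.Sigma) auto
  also have "\<dots> = (\<Sum>(p, q)\<in>Sigma (splits n) (\<lambda>p. splits (snd p)).
      ?f (fst p) * (?g (fst q) * ?h (snd q)))"
    by (rule sum.reindex_bij_witness[of _
          "\<lambda>((a, _), (b, c)). ((a + b, c), (a, b))" "\<lambda>((_, c), (a, b)). ((a, b + c), (b, c))"])
       (auto simp: splits_def add.assoc mult.assoc)
  also have "\<dots> = (\<Sum>p\<in>splits n. \<Sum>q\<in>splits (snd p). ?f (fst p) * (?g (fst q) * ?h (snd q)))"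
    by (subst sum.Sigma) auto
  also have "\<dots> = mfps_nth (f * (g * h)) n"
    by (simp add: times_mfps_def case_prod_unfold sum_distrib_left)
  finally show "mfps_nth ((f * g) * h) n = mfps_nth (f * (g * h)) n" .
qed

lemma mfps_mult_1: "1 * f = (f :: ('a, 'b) mfps)"
proof (rule mfps_eqI)
  fix n
  have "mfps_nth (1 * f) n = (\<Sum>(a, b)\<in>splits n. (if a = 0 then 1 else 0) * mfps_nth f b)"
    by (simp add: times_mfps_def one_mfps_def)
  also have "\<dots> = (\<Sum>(a, b)\<in>{(0 :: nat ^ 'b, n)}. (if a = 0 then 1 else 0) * mfps_nth f b)"
    by (rule sum.mono_neutral_right[OF finite_splits]) (auto simp: splits_def split: if_splits)
  finally show "mfps_nth (1 * f) n = mfps_nth f n" by simp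
qed

instance
proof
  fix f g h :: "('a, 'b) mfps"
  show "f * g * h = f * (g * h)" by (rule mfps_mult_assoc)
  show "f * g = g * f" by (rule mfps_mult_commute)
  show "1 * f = f" by (rule mfps_mult_1)
  show "(f + g) * h = f * h + g * h"
    by (rule mfps_eqI)
       (simp add: times_mfps_def plus_mfps_def case_prod_unfold distrib_right sum.distrib)
  show "f + g + h = f + (g + h)" by (simp add: plus_mfps_def add.assoc)
  show "f + g = g + f" by (simp add: plus_mfps_def add.commute)
  show "0 + f = f" by (rule mfps_eqI) (simp add: plus_mfps_def zero_mfps_def)
  show "- f + f = 0" by (simp add: plus_mfps_def zero_mfps_def uminus_mfps_def)
  show "f - g = f + - g" by (simp add: plus_mfps_def minus_mfps_def uminus_mfps_def)
  have "mfps_nth (0 :: ('a, 'b) mfps) 0 \<noteq> mfps_nth 1 0"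
    by (simp add: zero_mfps_def one_mfps_def)
  then show "(0 :: ('a, 'b) mfps) \<noteq> 1" by metis
qed

end

lemma mfps_nth_one: "mfps_nth 1 n = (if n = 0 then 1 else 0)"
  by (simp add: one_mfps_def)

lemma mfps_nth_diff: "mfps_nth (f - g) n = mfps_nth f n - mfps_nth g n"
  by (simp add: minus_mfps_def)

lemma mfps_nth_mult: "mfps_nth (f * g) n = (\<Sum>(a, b)\<in>splits n. mfps_nth f a * mfps_nth g b)"
  by (simp add: times_mfps_def)

text \<open>As usual in a ring, \<open>inverse f\<close> is only meaningful when \<open>f\<close> is a unit.\<close>

instantiation mfps :: (comm_ring_1, finite) inverse
begin
definition inverse_mfps :: "('a, 'b) mfps \<Rightarrow> ('a, 'b) mfps" where
  "inverse_mfps f = (THE g. f * g = 1)"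
definition divide_mfps :: "('a, 'b) mfps \<Rightarrow> ('a, 'b) mfps \<Rightarrow> ('a, 'b) mfps" where
  "divide_mfps f g = f * inverse g"
instance ..
end

lemma inverse_mfps_eqI:
  fixes f g :: "('a::comm_ring_1, 'd::finite) mfps"
  assumes "f * g = 1"
  shows "inverse f = g"
  unfolding inverse_mfps_def
proof (rule the_equality)
  fix h assume "f * h = 1"
  have "h = (f * g) * h" using assms by simp
  also have "\<dots> = g * (f * h)" by (simp only: mult.assoc mult.left_commute)
  also have "\<dots> = g" by (simp add: \<open>f * h = 1\<close>)
  finally show "h = g" .
qed (rule assms)

definition mfps_monom :: "nat ^ 'd::finite \<Rightarrow> ('a::comm_ring_1, 'd) mfps" where
  "mfps_monom i = Abs_mfps (\<lambda>n. if n = i then 1 else 0)"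

lemma mfps_nth_monom_mult:
  "mfps_nth (mfps_monom i * f) n = (if i \<le> n then mfps_nth f (n - i) else 0)"
proof -
  have "mfps_nth (mfps_monom i * f) n
      = (\<Sum>(a, b)\<in>splits n. (if a = i then 1 else 0) * mfps_nth f b)"
    by (simp add: mfps_nth_mult mfps_monom_def)
  also have "\<dots> = (\<Sum>(a, b)\<in>(if i \<le> n then {(i, n - i)} else {}).
      (if a = i then 1 else 0) * mfps_nth f b)"
  proof (rule sum.mono_neutral_right)
    have diff: "i \<le> n \<and> b = n - i" if "i + b = n" for b
      unfolding that[symmetric] by (simp add: less_eq_vec_def vec_eq_iff)
    have add: "i + (n - i) = n" if "i \<le> n"
      using that by (simp add: less_eq_vec_def vec_eq_iff)
    show "(if i \<le> n then {(i, n - i)} else {}) \<subseteq> splits n"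
      using add by (simp add: splits_def)
    show "\<forall>x\<in>splits n - (if i \<le> n then {(i, n - i)} else {}).
        (case x of (a, b) \<Rightarrow> (if a = i then 1 else 0) * mfps_nth f b) = 0"
      using diff by (auto simp: splits_def split: if_splits)
  qed simp
  finally show ?thesis by simp
qed

lemma inverse_one_minus_monom:
  fixes i :: "nat ^ 'd::finite"
  assumes "i \<noteq> 0"
  shows "(1 - mfps_monom i) * inverse (1 - mfps_monom i) = (1 :: ('a::comm_ring_1, 'd) mfps)"
    and "inverse (1 - mfps_monom i :: ('a, 'd) mfps)
      = Abs_mfps (\<lambda>n. if \<exists>k. \<forall>l. n $ l = k * i $ l then 1 else 0)"
proof -
  let ?g = "Abs_mfps (\<lambda>n. if \<exists>k. \<forall>l. n $ l = k * i $ l then 1 else 0) :: ('a, 'd) mfps"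
  have "(1 - mfps_monom i) * ?g = 1"
  proof (rule mfps_eqI)
    fix n :: "nat ^ 'd"
    have eq: "mfps_nth ((1 - mfps_monom i) * ?g) n
        = mfps_nth ?g n - (if i \<le> n then mfps_nth ?g (n - i) else 0)"
      by (simp only: left_diff_distrib mfps_nth_diff mfps_nth_monom_mult mult_1_left)
    show "mfps_nth ((1 - mfps_monom i) * ?g) n = mfps_nth 1 n"
    proof (cases "n = 0")
      case True
      have "\<exists>k. \<forall>l. n $ l = k * i $ l" using True by (intro exI[of _ 0]) simp
      moreover have "\<not> i \<le> n" using True assms by (auto simp: less_eq_vec_def vec_eq_iff)
      ultimately show ?thesis unfolding eq using True by (simp add: mfps_nth_one)
    next
      case False
      have "(\<exists>k. \<forall>l. n $ l = k * i $ l) \<longleftrightarrow> i \<le> n \<and> (\<exists>k. \<forall>l. (n - i) $ l = k * i $ l)"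
      proof
        assume "\<exists>k. \<forall>l. n $ l = k * i $ l"
        then obtain k where k: "\<forall>l. n $ l = k * i $ l" ..
        with False have "k \<noteq> 0" by (auto simp: vec_eq_iff)
        then obtain k' where "k = Suc k'" by (cases k) auto
        then show "i \<le> n \<and> (\<exists>k. \<forall>l. (n - i) $ l = k * i $ l)"
          using k by (auto simp: less_eq_vec_def intro!: exI[of _ k'])
      next
        assume a: "i \<le> n \<and> (\<exists>k. \<forall>l. (n - i) $ l = k * i $ l)"
        then obtain k where k: "\<forall>l. (n - i) $ l = k * i $ l" by auto
        have "n $ l = Suc k * i $ l" for l
        proof -
          have "i $ l \<le> n $ l" using a by (simp add: less_eq_vec_def)
          moreover have "n $ l - i $ l = k * i $ l" using k by simp
          ultimately show ?thesis by simp
        qed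
        then show "\<exists>k. \<forall>l. n $ l = k * i $ l" by blast
      qed
      then show ?thesis unfolding eq using False by (auto simp: mfps_nth_one)
    qed
  qed
  moreover from this have "inverse (1 - mfps_monom i :: ('a, 'd) mfps) = ?g"
    by (rule inverse_mfps_eqI)
  ultimately show "(1 - mfps_monom i) * inverse (1 - mfps_monom i) = (1 :: ('a, 'd) mfps)"
    and "inverse (1 - mfps_monom i :: ('a, 'd) mfps) = ?g"
    by (simp_all only:)
qed

text \<open>
  \<open>mfps_has_prod f A F\<close>: the unordered, possibly infinite product of the \<open>f i\<close>, \<open>i \<in> A\<close>, is \<open>F\<close>
  as a formal power series, i.e. every coefficient of the finite partial products is eventually
  equal to that of \<open>F\<close>.
\<close>

definition mfps_has_prod ::
  "('i \<Rightarrow> ('a::comm_ring_1, 'd::finite) mfps) \<Rightarrow> 'i set \<Rightarrow> ('a, 'd) mfps \<Rightarrow> bool" where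
  "mfps_has_prod f A F \<longleftrightarrow>
     (\<forall>n. \<forall>\<^sub>F S in finite_subsets_at_top A. mfps_nth (\<Prod>i\<in>S. f i) n = mfps_nth F n)"

lemma mfps_has_prod_unique:
  assumes "mfps_has_prod f A F" "mfps_has_prod f A G"
  shows "F = G"
proof (rule mfps_eqI)
  fix n
  have "\<forall>\<^sub>F S in finite_subsets_at_top A. mfps_nth F n = mfps_nth G n"
    using assms[unfolded mfps_has_prod_def, rule_format, of n]
    by eventually_elim simp
  then show "mfps_nth F n = mfps_nth G n" by simp
qed

text \<open>
  \<open>THE\<close> is justified by \<open>mfps_has_prod_unique\<close> and \<open>vector_partition_number_gf\<close>.
\<close>

definition vector_partition_number :: "nat ^ 'd::finite \<Rightarrow> int" where
  "vector_partition_number = (THE p.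
     mfps_has_prod (\<lambda>i. inverse (1 - mfps_monom i)) {i. \<forall>l. 1 \<le> i $ l} (Abs_mfps p))"

lemma mfps_mult_agree:
  assumes "\<And>m. m \<le> n \<Longrightarrow> mfps_nth f m = mfps_nth f' m"
    and "\<And>m. m \<le> n \<Longrightarrow> mfps_nth g m = mfps_nth g' m" and "m \<le> n"
  shows "mfps_nth (f * g) m = mfps_nth (f' * g') m"
  unfolding mfps_nth_mult
proof (rule sum.cong, safe)
  fix a b assume "(a, b) \<in> splits m"
  then have "a \<le> n" "b \<le> n" using splits_le assms(3) order_trans by blast+
  then show "mfps_nth f a * mfps_nth g b = mfps_nth f' a * mfps_nth g' b"
    using assms by simp
qed

theorem vector_partition_number_gf:
  "mfps_has_prod (\<lambda>i. inverse (1 - mfps_monom i)) {i :: nat ^ 'd::finite. \<forall>l. 1 \<le> i $ l}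
     (Abs_mfps vector_partition_number)"
proof -
  let ?A = "{i :: nat ^ 'd. \<forall>l. 1 \<le> i $ l}"
  let ?g = "\<lambda>i. inverse (1 - mfps_monom i) :: (int, 'd) mfps"
  define B where "B = (\<lambda>n. {i \<in> ?A. i \<le> n})"
  define p where "p = (\<lambda>n. mfps_nth (\<Prod>i\<in>B n. ?g i) n)"
  have fin: "finite (B n)" for n
    unfolding B_def by (rule finite_subset[OF _ finite_vec_atMost[of n]]) auto
  have one: "mfps_nth (?g i) m = mfps_nth 1 m" if "i \<in> ?A" "\<not> i \<le> n" "m \<le> n" for i n m
  proof -
    have "i \<noteq> 0" using that(1) by (metis (mono_tags) mem_Collect_eq not_one_le_zero zero_index)
    moreover have "(\<exists>k. \<forall>l. m $ l = k * i $ l) \<longleftrightarrow> m = 0"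
    proof
      assume "\<exists>k. \<forall>l. m $ l = k * i $ l"
      then obtain k where k: "\<forall>l. m $ l = k * i $ l" ..
      have "k = 0"
      proof (rule ccontr)
        assume "k \<noteq> 0"
        then have "i \<le> m" using k by (auto simp: less_eq_vec_def)
        with that show False using order_trans by blast
      qed
      then show "m = 0" using k by (simp add: vec_eq_iff)
    qed (auto intro: exI[of _ 0])
    ultimately show ?thesis by (simp add: inverse_one_minus_monom(2) mfps_nth_one)
  qed
  have rest: "mfps_nth (\<Prod>i\<in>T. ?g i) m = mfps_nth 1 m"
    if "finite T" "T \<subseteq> ?A - B n" "m \<le> n" for T n m
    using that
  proof (induction T arbitrary: m rule: finite_induct)
    case (insert i T)
    have "mfps_nth (?g i * (\<Prod>i\<in>T. ?g i)) m = mfps_nth (1 * 1) m"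
    proof (rule mfps_mult_agree[of n])
      show "mfps_nth (?g i) m = mfps_nth 1 m" if "m \<le> n" for m
        using one[of i n m] insert.prems that by (auto simp: B_def)
    qed (use insert in auto)
    then show ?case using insert by simp
  qed simp
  have "mfps_has_prod ?g ?A (Abs_mfps p)"
    unfolding mfps_has_prod_def
  proof
    fix n
    show "\<forall>\<^sub>F S in finite_subsets_at_top ?A.
        mfps_nth (\<Prod>i\<in>S. ?g i) n = mfps_nth (Abs_mfps p) n"
      unfolding eventually_finite_subsets_at_top
    proof (intro exI[of _ "B n"] conjI allI impI)
      fix S assume S: "finite S \<and> B n \<subseteq> S \<and> S \<subseteq> ?A"
      have "(\<Prod>i\<in>S. ?g i) = (\<Prod>i\<in>B n. ?g i) * (\<Prod>i\<in>S - B n. ?g i)"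
        using S by (metis mult.commute prod.subset_diff)
      moreover have "mfps_nth ((\<Prod>i\<in>B n. ?g i) * (\<Prod>i\<in>S - B n. ?g i)) n
          = mfps_nth ((\<Prod>i\<in>B n. ?g i) * 1) n"
        by (rule mfps_mult_agree[of n]) (use S in \<open>auto intro!: rest\<close>)
      ultimately show "mfps_nth (\<Prod>i\<in>S. ?g i) n = mfps_nth (Abs_mfps p) n"
        by (simp add: p_def)
    qed (use fin in \<open>auto simp: B_def\<close>)
  qed
  moreover have "q = p" if "mfps_has_prod ?g ?A (Abs_mfps q)" for q
    using mfps_has_prod_unique[OF that calculation] by (metis mfps_nth_Abs)
  ultimately show ?thesis
    unfolding vector_partition_number_def by (rule theI)
qed

text \<open>
  A \<open>d\<close>-dimensional partition is an array indexed by vectors of positive integers; it is encoded as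
  a function on \<open>nat ^ 'd\<close> with value \<open>0\<close> at the indices having a zero component, so that distinct
  functions are distinct arrays. The order on \<open>nat ^ 'd\<close> is componentwise.
\<close>

definition d_partitions :: "(nat ^ 'd::finite \<Rightarrow> nat) set" where
  "d_partitions = {\<pi>.
     finite {i. \<pi> i \<noteq> 0} \<and>
     (\<forall>i. \<not> (\<forall>l. 1 \<le> i $ l) \<longrightarrow> \<pi> i = 0) \<and>
     (\<forall>i j. (\<forall>l. 1 \<le> i $ l) \<and> (\<forall>l. 1 \<le> j $ l) \<and> i \<le> j \<longrightarrow> \<pi> j \<le> \<pi> i)}"

text \<open>
  A point of the diagram, \<open>(i\<^sub>1, \<dots>, i\<^sub>d, k)\<close>, is the pair of \<open>(i\<^sub>1, \<dots>, i\<^sub>d)\<close> and \<open>k\<close>;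
  \<open>axis l 1\<close> is the \<open>l\<close>-th standard basis vector.
\<close>

definition diagram :: "(nat ^ 'd::finite \<Rightarrow> nat) \<Rightarrow> ((nat ^ 'd) \<times> nat) set" where
  "diagram \<pi> = {(i, k). (\<forall>l. 1 \<le> i $ l) \<and> 1 \<le> k \<and> k \<le> \<pi> i}"

definition corners :: "(nat ^ 'd::finite \<Rightarrow> nat) \<Rightarrow> ((nat ^ 'd) \<times> nat) set" where
  "corners \<pi> = {(i, k). (i, k) \<in> diagram \<pi> \<and> (\<forall>l. (i + axis l 1, k) \<notin> diagram \<pi>)}"

definition corner_sum :: "'d::finite \<Rightarrow> (nat ^ 'd \<Rightarrow> nat) \<Rightarrow> nat" where
  "corner_sum l \<pi> = (\<Sum>(i, k)\<in>corners \<pi>. i $ l)"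

end

theory Submission
  imports Defs
begin

text \<open>
  Expanding the product, \<open>p(n)\<close> counts the finitely supported weights \<open>w\<close> on positive index
  vectors with \<open>\<Sum> w\<^sub>i i = n\<close>. A partition \<open>\<pi>\<close> has exactly
  \<open>w\<^sub>i = \<pi>\<^sub>i - max\<^sub>l \<pi>\<^bsub>i + e\<^sub>l\<^esub>\<close> corners above the index \<open>i\<close>, so its corner sums are the components
  of \<open>\<Sum> w\<^sub>i i\<close>. Conversely \<open>w\<close> determines \<open>\<pi>\<close> as the last passage time
  \<open>\<pi>\<^sub>i = w\<^sub>i + max\<^sub>l \<pi>\<^bsub>i + e\<^sub>l\<^esub>\<close>, computed downwards from large indices, where \<open>\<pi>\<close> vanishes.
\<close>

section \<open>Expansion of the product: \<open>vector_partition_number\<close> counts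
  weights\<close>

definition weights :: "(nat ^ 'd::finite) set \<Rightarrow> nat ^ 'd \<Rightarrow> (nat ^ 'd \<Rightarrow> nat) set" where
  "weights S n = {w. finite {i. w i \<noteq> 0} \<and> {i. w i \<noteq> 0} \<subseteq> S \<and> (\<Sum>i | w i \<noteq> 0. w i *s i) = n}"

lemma weights_finite_eq:
  assumes "finite S"
  shows "weights S n = {w. {i. w i \<noteq> 0} \<subseteq> S \<and> (\<Sum>i\<in>S. w i *s i) = n}"
proof -
  have "(\<Sum>i | w i \<noteq> 0. w i *s i) = (\<Sum>i\<in>S. w i *s i)" if "{i. w i \<noteq> 0} \<subseteq> S" for w
    using assms that by (intro sum.mono_neutral_left) (auto simp: vec_eq_iff)
  then show ?thesis
    using finite_subset[OF _ assms] by (auto simp: weights_def)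
qed

text \<open>Splitting off the index \<open>i\<close> mirrors the Cauchy product with the geometric
  series of \<open>i\<close>: the pair \<open>(a, b)\<close> records how \<open>n\<close> is divided
  between \<open>i\<close> and \<open>S\<close>. As \<open>i\<close> is nonzero, the multiplicity of
  \<open>i\<close> can be read off from \<open>a\<close>.\<close>

lemma weights_insert_bij_betw:
  fixes i :: "nat ^ 'd::finite"
  assumes "finite S" "i \<notin> S" "i \<noteq> 0"
  shows "bij_betw (\<lambda>w. ((w i *s i, \<Sum>j\<in>S. w j *s j), w(i := 0))) (weights (insert i S) n)
    (Sigma {(a, b) \<in> splits n. \<exists>k. a = k *s i} (\<lambda>p. weights S (snd p)))"
proof (rule bij_betw_imageI)
  have inj: "k = k'" if "k *s i = k' *s i" for k k'
    using that assms(3) by (auto simp: vec_eq_iff)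
  show "inj_on (\<lambda>w. ((w i *s i, \<Sum>j\<in>S. w j *s j), w(i := 0))) (weights (insert i S) n)"
  proof (rule inj_onI)
    fix w w' :: "nat ^ 'd \<Rightarrow> nat"
    assume "((w i *s i, \<Sum>j\<in>S. w j *s j), w(i := 0))
      = ((w' i *s i, \<Sum>j\<in>S. w' j *s j), w'(i := 0))"
    then have "w i = w' i" "w(i := 0) = w'(i := 0)" using inj by auto
    then show "w = w'" by (metis fun_upd_triv fun_upd_upd)
  qed
  have upd: "(\<Sum>j\<in>S. (w(i := k)) j *s j) = (\<Sum>j\<in>S. w j *s j)" for w k
    using assms(2) by (intro sum.cong) auto
  show "(\<lambda>w. ((w i *s i, \<Sum>j\<in>S. w j *s j), w(i := 0))) ` weights (insert i S) n
    = Sigma {(a, b) \<in> splits n. \<exists>k. a = k *s i} (\<lambda>p. weights S (snd p))"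
  proof (rule set_eqI, rule iffI)
    fix x assume "x \<in> (\<lambda>w. ((w i *s i, \<Sum>j\<in>S. w j *s j), w(i := 0))) ` weights (insert i S) n"
    then show "x \<in> Sigma {(a, b) \<in> splits n. \<exists>k. a = k *s i} (\<lambda>p. weights S (snd p))"
      using assms(1,2) by (auto simp: weights_finite_eq splits_def upd simp del: fun_upd_apply)
        (auto split: if_splits)
  next
    fix x assume "x \<in> Sigma {(a, b) \<in> splits n. \<exists>k. a = k *s i} (\<lambda>p. weights S (snd p))"
    then obtain k b w where x: "x = ((k *s i, b), w)" and n: "k *s i + b = n"
      and w: "{j. w j \<noteq> 0} \<subseteq> S" "(\<Sum>j\<in>S. w j *s j) = b"
      using assms(1) by (auto simp: weights_finite_eq splits_def)
    \<comment> \<open>Since \<open>w\<close> is supported in \<open>S\<close>, its entry at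
      \<open>i\<close> is free to receive the multiplicity \<open>k\<close>.\<close>
    have "w i = 0" using w(1) assms(2) by auto
    then have "w = (w(i := k))(i := 0)" by auto
    then have "x = (((w(i := k)) i *s i, \<Sum>j\<in>S. (w(i := k)) j *s j), (w(i := k))(i := 0))"
      unfolding x upd using w(2) by simp
    moreover have "w(i := k) \<in> weights (insert i S) n"
      using assms(1,2) w n upd[of w k] by (auto simp: weights_finite_eq)
    ultimately show "x \<in> (\<lambda>w. ((w i *s i, \<Sum>j\<in>S. w j *s j), w(i := 0))) ` weights (insert i S) n"
      by (rule image_eqI)
  qed
qed

text \<open>Each factor is a geometric series with coefficient 1 exactly at the multiples of
  \<open>i\<close>, so multiplying by it sums the earlier counts over the splittings just described.
  Finiteness is carried through the induction because the cardinality of the \<open>Sigma\<close>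
  set depends on it.\<close>

lemma coeff_prod_inverse_one_minus_monom:
  fixes S :: "(nat ^ 'd::finite) set"
  assumes "finite S" "0 \<notin> S"
  shows "finite (weights S n) \<and>
    mfps_nth (\<Prod>i\<in>S. inverse (1 - mfps_monom i) :: (int, 'd) mfps) n = int (card (weights S n))"
  using assms
proof (induction S arbitrary: n rule: finite_induct)
  case empty
  have "weights {} n = (if n = 0 then {\<lambda>_. 0} else {})"
    by (auto simp: weights_def)
  then show ?case by (auto simp: mfps_nth_one)
next
  case (insert i S)
  let ?T = "{(a, b) \<in> splits n. \<exists>k. a = k *s i}"
  have fin: "finite ?T" by (rule finite_subset[OF _ finite_splits[of n]]) auto
  have IH: "finite (weights S m)" "mfps_nth (\<Prod>i\<in>S. inverse (1 - mfps_monom i) :: (int, 'd) mfps) m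
      = int (card (weights S m))" for m
    using insert by auto
  have "i \<noteq> 0" using insert.prems by auto
  note bij = weights_insert_bij_betw[OF insert.hyps \<open>i \<noteq> 0\<close>, of n]
  have "finite (weights (insert i S) n)"
    unfolding bij_betw_finite[OF bij] using fin IH by blast
  moreover have "mfps_nth (\<Prod>i\<in>insert i S. inverse (1 - mfps_monom i) :: (int, 'd) mfps) n
      = (\<Sum>(a, b)\<in>splits n. if \<exists>k. a = k *s i then int (card (weights S b)) else 0)"
    using insert.hyps \<open>i \<noteq> 0\<close>
    by (auto simp: mfps_nth_mult IH inverse_one_minus_monom(2) vec_eq_iff intro!: sum.cong)
  moreover have "\<dots> = (\<Sum>p\<in>?T. int (card (weights S (snd p))))"
    by (rule sum.mono_neutral_cong_right) (auto split: if_split_asm)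
  moreover have "\<dots> = int (card (weights (insert i S) n))"
    unfolding bij_betw_same_card[OF bij] using fin IH by (subst card_SigmaI) auto
  ultimately show ?case by simp
qed

abbreviation positive_vecs :: "(nat ^ 'd::finite) set" where
  "positive_vecs \<equiv> {i. \<forall>l. 1 \<le> i $ l}"

text \<open>An index of nonzero weight contributes at least itself to the sum, hence lies below
  \<open>n\<close>. This reduces the infinite index set to a finite one.\<close>

lemma weights_restrict:
  assumes "{i \<in> A. i \<le> n} \<subseteq> S" "S \<subseteq> A"
  shows "weights A n = weights S n"
proof -
  have "i \<le> n" if "finite {i. w i \<noteq> 0}" "(\<Sum>i | w i \<noteq> 0. w i *s i) = n" "w i \<noteq> 0" for w i
  proof -
    have "i $ l \<le> n $ l" for l
    proof -
      have "i $ l \<le> w i * i $ l" using that(3) by simp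
      also have "\<dots> \<le> (\<Sum>i | w i \<noteq> 0. w i * i $ l)"
        using that by (intro member_le_sum) auto
      also have "\<dots> = n $ l" unfolding that(2)[symmetric] by simp
      finally show ?thesis .
    qed
    then show ?thesis by (simp add: less_eq_vec_def)
  qed
  then show ?thesis using assms unfolding weights_def by blast
qed

lemma vector_partition_number_eq_card_weights:
  fixes n :: "nat ^ 'd::finite"
  shows "finite (weights positive_vecs n) \<and>
    vector_partition_number n = int (card (weights positive_vecs n))"
proof -
  let ?B = "{i \<in> positive_vecs. i \<le> n}"
  have fin: "finite ?B"
    by (rule finite_subset[OF _ finite_vec_atMost[of n]]) auto
  have "\<forall>\<^sub>F S in finite_subsets_at_top positive_vecs.
      mfps_nth (\<Prod>i\<in>S. inverse (1 - mfps_monom i) :: (int, 'd) mfps) n = vector_partition_number n"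
    by (rule vector_partition_number_gf[unfolded mfps_has_prod_def mfps_nth_Abs, rule_format])
  moreover have "\<forall>\<^sub>F S in finite_subsets_at_top positive_vecs. finite S \<and> ?B \<subseteq> S \<and> S \<subseteq> positive_vecs"
    unfolding eventually_finite_subsets_at_top using fin by (intro exI[of _ ?B]) auto
  \<comment> \<open>Both properties hold eventually along a proper filter, so a single finite
    \<open>S\<close> has them together.\<close>
  ultimately have "\<forall>\<^sub>F S in finite_subsets_at_top positive_vecs. finite S \<and> ?B \<subseteq> S \<and> S \<subseteq> positive_vecs \<and>
      mfps_nth (\<Prod>i\<in>S. inverse (1 - mfps_monom i) :: (int, 'd) mfps) n = vector_partition_number n"
    by eventually_elim blast
  from eventually_happens'[OF finite_subsets_at_top_neq_bot this]
  obtain S :: "(nat ^ 'd) set" where S: "finite S" "?B \<subseteq> S" "S \<subseteq> positive_vecs"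
      "mfps_nth (\<Prod>i\<in>S. inverse (1 - mfps_monom i) :: (int, 'd) mfps) n = vector_partition_number n"
    by (elim exE conjE) (rule that)
  have "0 \<notin> S" using S(3) by auto
  then show ?thesis
    using coeff_prod_inverse_one_minus_monom[OF S(1), of n] S(4) weights_restrict[OF S(2,3)] by simp
qed

section \<open>Corners above a fixed index\<close>

definition max_succ :: "(nat ^ 'd::finite \<Rightarrow> nat) \<Rightarrow> nat ^ 'd \<Rightarrow> nat" where
  "max_succ \<pi> i = Max (range (\<lambda>l. \<pi> (i + axis l 1)))"

definition corner_count :: "(nat ^ 'd::finite \<Rightarrow> nat) \<Rightarrow> nat ^ 'd \<Rightarrow> nat" where
  "corner_count \<pi> i = (if i \<in> positive_vecs then \<pi> i - max_succ \<pi> i else 0)"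

lemma max_succ_less_iff: "max_succ \<pi> i < k \<longleftrightarrow> (\<forall>l. \<pi> (i + axis l 1) < k)"
  by (auto simp: max_succ_def)

lemma max_succ_le_iff: "max_succ \<pi> i \<le> k \<longleftrightarrow> (\<forall>l. \<pi> (i + axis l 1) \<le> k)"
  by (auto simp: max_succ_def)

lemma positive_vecs_add: "i \<in> positive_vecs \<Longrightarrow> i + j \<in> positive_vecs"
  by (auto intro: trans_le_add1)

text \<open>At a positive index, a level \<open>k >= 1\<close> passes the corner test in all
  directions exactly when it exceeds every successor entry, that is, their maximum. The corners
  above \<open>i\<close> thus fill an interval of length
  \<open>corner_count \<pi> i\<close>.\<close>

lemma corners_eq:
  "corners \<pi> = Sigma {i. corner_count \<pi> i \<noteq> 0} (\<lambda>i. {max_succ \<pi> i<..\<pi> i})"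
proof -
  have "(i, k) \<in> corners \<pi> \<longleftrightarrow> i \<in> positive_vecs \<and> max_succ \<pi> i < k \<and> k \<le> \<pi> i" for i k
  proof -
    have diagram: "(j, k) \<in> diagram \<pi> \<longleftrightarrow> j \<in> positive_vecs \<and> 1 \<le> k \<and> k \<le> \<pi> j" for j
      by (simp add: diagram_def)
    have "(\<forall>l. (i + axis l 1, k) \<notin> diagram \<pi>) \<longleftrightarrow> max_succ \<pi> i < k"
      if "i \<in> positive_vecs" "1 \<le> k"
      using that positive_vecs_add[OF that(1)]
      by (simp only: diagram max_succ_less_iff not_le simp_thms)
    then show ?thesis
      unfolding corners_def using diagram[of i] by auto
  qed
  then show ?thesis by (auto simp: corner_count_def)
qed

text \<open>Monotonicity makes the truncated subtraction exact, so an entry is recovered from its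
  corner count and its successors.\<close>

lemma corner_count_add_max_succ:
  assumes "\<pi> \<in> d_partitions" "i \<in> positive_vecs"
  shows "corner_count \<pi> i + max_succ \<pi> i = \<pi> i"
proof -
  have "i \<le> i + axis l 1" for l by (simp add: less_eq_vec_def)
  then have "max_succ \<pi> i \<le> \<pi> i"
    using assms positive_vecs_add[OF assms(2)] by (auto simp: max_succ_le_iff d_partitions_def)
  then show ?thesis using assms(2) by (simp add: corner_count_def)
qed

lemma finite_corner_count:
  assumes "\<pi> \<in> d_partitions"
  shows "finite {i. corner_count \<pi> i \<noteq> 0}"
proof (rule finite_subset)
  show "{i. corner_count \<pi> i \<noteq> 0} \<subseteq> {i. \<pi> i \<noteq> 0}" by (auto simp: corner_count_def)
qed (use assms in \<open>simp add: d_partitions_def\<close>)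

lemma corner_sum_eq:
  assumes "\<pi> \<in> d_partitions"
  shows "corner_sum l \<pi> = (\<Sum>i | corner_count \<pi> i \<noteq> 0. corner_count \<pi> i *s i) $ l"
proof -
  have "corner_sum l \<pi> = (\<Sum>i | corner_count \<pi> i \<noteq> 0. \<Sum>k\<in>{max_succ \<pi> i<..\<pi> i}. i $ l)"
    unfolding corner_sum_def corners_eq
    by (subst sum.Sigma) (use finite_corner_count[OF assms] in auto)
  also have "\<dots> = (\<Sum>i | corner_count \<pi> i \<noteq> 0. corner_count \<pi> i * i $ l)"
    by (rule sum.cong) (auto simp: corner_count_def split: if_splits)
  finally show ?thesis by simp
qed

section \<open>Recovering a partition from its corner counts\<close>

definition height :: "nat ^ 'd::finite \<Rightarrow> nat" where
  "height i = (\<Sum>l\<in>UNIV. i $ l)"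

lemma height_add_axis: "height (i + axis l 1) = Suc (height i)"
  by (simp add: height_def sum.distrib axis_def)

lemma finite_height_less: "finite {i :: nat ^ 'd::finite. height i < N}"
proof (rule finite_subset)
  have "i $ l \<le> height i" for i :: "nat ^ 'd" and l
    unfolding height_def by (rule member_le_sum) auto
  then show "{i :: nat ^ 'd. height i < N} \<subseteq> {i. i \<le> (\<chi> l. N)}"
    by (auto simp: less_eq_vec_def intro: order_trans[OF _ less_imp_le])
qed (rule finite_vec_atMost)

lemma finite_height_bound:
  assumes "finite A"
  obtains N where "\<And>i. i \<in> A \<Longrightarrow> height i < N"
  using finite_nat_set_iff_bounded[of "height ` A"] assms by auto

lemma inj_on_corner_count: "inj_on corner_count d_partitions"
proof (rule inj_onI)
  fix \<pi> \<pi>' :: "nat ^ 'd \<Rightarrow> nat"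
  assume \<pi>: "\<pi> \<in> d_partitions" "\<pi>' \<in> d_partitions" and eq: "corner_count \<pi> = corner_count \<pi>'"
  have "finite ({i. \<pi> i \<noteq> 0} \<union> {i. \<pi>' i \<noteq> 0})" using \<pi> by (simp add: d_partitions_def)
  then obtain N where "\<And>i. i \<in> {i. \<pi> i \<noteq> 0} \<union> {i. \<pi>' i \<noteq> 0} \<Longrightarrow> height i < N"
    by (metis finite_height_bound)
  then have N: "height i < N" if "\<pi> i \<noteq> 0 \<or> \<pi>' i \<noteq> 0" for i
    using that by blast
  \<comment> \<open>Downward induction on the height: from height \<open>N\<close> on both arrays
    vanish, and below it each entry is determined by entries one level higher.\<close>
  have "\<pi> i = \<pi>' i" if "N - height i = m" for m i
    using that
  proof (induction m arbitrary: i rule: less_induct)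
    case (less m)
    consider "i \<notin> positive_vecs" | "N \<le> height i" | "i \<in> positive_vecs" "height i < N"
      by linarith
    then show ?case
    proof cases
      case 1
      then show ?thesis using \<pi> by (auto simp: d_partitions_def)
    next
      case 2
      then show ?thesis using N[of i] by linarith
    next
      case 3
      have "\<pi> (i + axis l 1) = \<pi>' (i + axis l 1)" for l
        using less.prems 3(2) by (intro less.IH[OF _ refl]) (simp add: height_add_axis del: One_nat_def)
      then have "max_succ \<pi> i = max_succ \<pi>' i" by (simp add: max_succ_def)
      then show ?thesis
        using corner_count_add_max_succ[OF \<pi>(1) 3(1)] corner_count_add_max_succ[OF \<pi>(2) 3(1)] eq
        by simp
    qed
  qed
  then show "\<pi> = \<pi>'" by blast
qed

text \<open>Maximal weight of a directed lattice path with \<open>m\<close> vertices starting at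
  \<open>i\<close>. The argument \<open>m\<close> serves as fuel, since the recursion runs towards
  larger indices.\<close>

primrec passage_time :: "(nat ^ 'd::finite \<Rightarrow> nat) \<Rightarrow> nat \<Rightarrow> nat ^ 'd \<Rightarrow> nat" where
  "passage_time w 0 i = 0"
| "passage_time w (Suc m) i = w i + max_succ (passage_time w m) i"

text \<open>If \<open>i\<close> differs from \<open>j\<close>, some coordinate leaves room for a
  unit step that stays below \<open>j\<close> and shrinks the height difference.\<close>

lemma decreasing_if_steps:
  fixes \<pi> :: "nat ^ 'd::finite \<Rightarrow> nat"
  assumes step: "\<And>i l. i \<in> positive_vecs \<Longrightarrow> \<pi> (i + axis l 1) \<le> \<pi> i"
    and "i \<in> positive_vecs" "i \<le> j"
  shows "\<pi> j \<le> \<pi> i"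
  using assms(2,3)
proof (induction "height j - height i" arbitrary: i rule: less_induct)
  case less
  show ?case
  proof (cases "i = j")
    case False
    then obtain l where "i $ l \<noteq> j $ l" by (auto simp: vec_eq_iff)
    moreover have "\<forall>l. i $ l \<le> j $ l" using less.prems(2) by (simp add: less_eq_vec_def)
    ultimately have "i + axis l 1 \<le> j"
      by (auto simp: less_eq_vec_def axis_def Suc_le_eq less_le)
    moreover from this have "height (i + axis l 1) \<le> height j"
      unfolding height_def by (intro sum_mono) (simp add: less_eq_vec_def)
    ultimately have "\<pi> j \<le> \<pi> (i + axis l 1)"
      using less.prems(1) by (intro less.hyps positive_vecs_add) (simp_all add: height_add_axis del: One_nat_def)
    with step[OF less.prems(1)] show ?thesis by (rule order_trans[rotated])
  qed simp
qed

lemma corner_count_surj: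
  fixes w :: "nat ^ 'd::finite \<Rightarrow> nat"
  assumes "finite {i. w i \<noteq> 0}" "{i. w i \<noteq> 0} \<subseteq> positive_vecs"
  obtains \<pi> where "\<pi> \<in> d_partitions" "corner_count \<pi> = w"
proof -
  obtain N where "\<And>i. i \<in> {i. w i \<noteq> 0} \<Longrightarrow> height i < N"
    using finite_height_bound[OF assms(1)] by metis
  then have N: "w i = 0" if "N \<le> height i" for i
    using that by (metis mem_Collect_eq not_le)
  \<comment> \<open>With fuel \<open>N - height i\<close>, paths stop on reaching height
    \<open>N\<close>, beyond which \<open>w\<close> vanishes. One step uses one unit of fuel and
    raises the height by one, so the fuel of the successors fits the recursion.\<close>
  define \<pi> where "\<pi> i = (if i \<in> positive_vecs then passage_time w (N - height i) i else 0)" for i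
  have rec: "\<pi> i = w i + max_succ \<pi> i" if i: "i \<in> positive_vecs" for i
  proof -
    have succ: "\<pi> (i + axis l 1) = passage_time w (N - Suc (height i)) (i + axis l 1)" for l
      unfolding \<pi>_def using positive_vecs_add[OF i] by (simp only: height_add_axis if_True)
    show ?thesis
    proof (cases "height i < N")
      case True
      then have "N - height i = Suc (N - Suc (height i))" by simp
      then show ?thesis using i succ by (simp add: \<pi>_def[of i] max_succ_def)
    next
      \<comment> \<open>Here the fuel is 0 at \<open>i\<close> and at all its successors, and
        \<open>w i = 0\<close>, so the recursion reads 0 = 0 + 0.\<close>
      case False
      then show ?thesis using i succ N[of i] by (simp add: \<pi>_def[of i] max_succ_def)
    qed
  qed
  have "\<pi> (i + axis l 1) \<le> \<pi> i" if "i \<in> positive_vecs" for i l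
    using rec[OF that] max_succ_le_iff[of \<pi> i "\<pi> i"] by simp
  then have "\<pi> j \<le> \<pi> i" if "i \<in> positive_vecs" "i \<le> j" for i j
    using decreasing_if_steps that by blast
  moreover have "\<pi> i = 0" if "i \<notin> positive_vecs" for i
    using that by (simp only: \<pi>_def if_False)
  moreover have "finite {i. \<pi> i \<noteq> 0}"
  proof (rule finite_subset[OF _ finite_height_less[of N]])
    have "\<pi> i = 0" if "N \<le> height i" for i
      using that by (simp add: \<pi>_def)
    then show "{i. \<pi> i \<noteq> 0} \<subseteq> {i. height i < N}"
      by (metis (mono_tags) Collect_mono not_le)
  qed
  ultimately have "\<pi> \<in> d_partitions"
    unfolding d_partitions_def by blast
  moreover have "corner_count \<pi> i = w i" for i
    using rec[of i] assms(2) by (auto simp: corner_count_def)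
  ultimately show thesis using that by blast
qed

section \<open>The bijection between partitions and weights\<close>

lemma bij_betw_corner_count:
  "bij_betw corner_count {\<pi> \<in> d_partitions. \<forall>l. corner_sum l \<pi> = n $ l} (weights positive_vecs n)"
proof (rule bij_betw_imageI)
  show "inj_on corner_count {\<pi> \<in> d_partitions. \<forall>l. corner_sum l \<pi> = n $ l}"
    by (rule inj_on_subset[OF inj_on_corner_count]) auto
  have iff: "corner_count \<pi> \<in> weights positive_vecs n \<longleftrightarrow> (\<forall>l. corner_sum l \<pi> = n $ l)"
    if "\<pi> \<in> d_partitions" for \<pi>
  proof -
    have "{i. corner_count \<pi> i \<noteq> 0} \<subseteq> positive_vecs"
      by (auto simp: corner_count_def split: if_splits)
    then show ?thesis
      using finite_corner_count[OF that] corner_sum_eq[OF that]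
      by (simp add: weights_def vec_eq_iff)
  qed
  show "corner_count ` {\<pi> \<in> d_partitions. \<forall>l. corner_sum l \<pi> = n $ l} = weights positive_vecs n"
  proof (intro equalityI subsetI)
    fix w assume w: "w \<in> weights positive_vecs n"
    then obtain \<pi> where "\<pi> \<in> d_partitions" "corner_count \<pi> = w"
      using corner_count_surj[of w] by (auto simp: weights_def)
    then show "w \<in> corner_count ` {\<pi> \<in> d_partitions. \<forall>l. corner_sum l \<pi> = n $ l}"
      using iff w by blast
  qed (use iff in blast)
qed

text \<open>Finiteness is asserted too because \<open>card\<close> is 0 on infinite sets; both
  claims transfer from weights along the bijection.\<close>

theorem lemma5p1:
  fixes n :: "nat ^ 'd::finite"
  shows "finite {\<pi> \<in> d_partitions. \<forall>l. corner_sum l \<pi> = n $ l} \<and>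
         vector_partition_number n = int (card {\<pi> \<in> d_partitions. \<forall>l. corner_sum l \<pi> = n $ l})"
  using vector_partition_number_eq_card_weights[of n]
  unfolding bij_betw_finite[OF bij_betw_corner_count, symmetric]
    bij_betw_same_card[OF bij_betw_corner_count, symmetric] .

end
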